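(* Let $u_0\in L^1(\mathbb{R}_+,(1+x+x^2)\,dx)$ and let $u$ be the solution to the heat equation on the half-line $$u_t=u_{xx}\ \ (x\in\mathbb{R}_+,\ t>0),\qquad u(0,t)=0\ \ (t>0),\qquad u(x,0)=u_0(x)\ \ (x\in\mathbb{R}_+).$$ Let $M_1^*=\int_0^\infty u_0(x)\,x\,dx$. Then $$\sup_{x\ge 0}\ \frac{t^{3/2}}{x+1}\Big|u(x,t)+2M_1^*D(x,t)\Big|\to 0\qquad\text{as }t\to\infty .$$
   Context: $\mathbb{R}_+=(0,\infty)$. $\Gamma(x,t)=(4\pi t)^{-1/2}e^{-x^2/(4t)}$ is the fundamental solution of the heat equation $u_t=u_{xx}$ on $\mathbb{R}$, and $D(x,t)=\Gamma_x(x,t)=\partial_x\Gamma(x,t)$ is the dipole solution. The solution $u$ is the one given by $u(x,t)=\int_0^\infty\big(\Gamma(x-y,t)-\Gamma(x+y,t)\big)u_0(y)\,dy$ for $x\ge0$, $t>0$. *)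

theory Defs
  imports "HOL-Analysis.Analysis"
begin

definition heat_kernel :: "real \<Rightarrow> real \<Rightarrow> real" where
  "heat_kernel x t = (4 * pi * t) powr (-1/2) * exp (- (x\<^sup>2) / (4 * t))"

definition dipole :: "real \<Rightarrow> real \<Rightarrow> real" where
  "dipole x t = deriv (\<lambda>y. heat_kernel y t) x"

text \<open>The weighted space \<open>L\<^sup>1((0,\<infinity>), (1 + x + x\<^sup>2) dx)\<close>, as a set of Lebesgue measurable functions.
  Elements are total functions on the reals; only their values on \<open>(0,\<infinity>)\<close> matter.\<close>

definition weighted_L1 :: "(real \<Rightarrow> real) set" where
  "weighted_L1 =
    {f. integrable (density (lebesgue_on {0<..}) (\<lambda>x. ennreal (1 + x + x\<^sup>2))) f}"

text \<open>The solution of \<open>u\<^sub>t = u\<^sub>x\<^sub>x\<close> on the half-line with zero Dirichlet condition at \<open>x = 0\<close> and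
  initial datum \<open>u0\<close>, given by odd reflection. It is meaningful for \<open>x \<ge> 0\<close> and \<open>t > 0\<close>.\<close>

definition halfline_heat :: "(real \<Rightarrow> real) \<Rightarrow> real \<Rightarrow> real \<Rightarrow> real" where
  "halfline_heat u0 x t =
    (LINT y:{0<..}|lebesgue. (heat_kernel (x - y) t - heat_kernel (x + y) t) * u0 y)"

definition first_moment :: "(real \<Rightarrow> real) \<Rightarrow> real" where
  "first_moment u0 = (LINT x:{0<..}|lebesgue. u0 x * x)"

end

theory Submission
  imports Defs
begin

text \<open>
  Since \<open>2 * first_moment u0\<close> is itself an integral of \<open>u0\<close>, the quantity to be estimated is the
  integral over \<open>y > 0\<close> of \<open>u0 y\<close> against the remainder
  \<open>K = heat_kernel (x - y) t - heat_kernel (x + y) t + 2 * y * dipole x t\<close>,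
  which is what is left of the half-line solution started from a unit mass at \<open>y\<close> after subtracting
  the leading term \<open>- 2 * y * dipole x t\<close> of its Taylor expansion in \<open>y\<close>.  Two cancellations make \<open>K\<close> small: it is of second order in
  \<open>y\<close> at \<open>y = 0\<close> because the dipole is the first-order term, and it vanishes at \<open>x = 0\<close> because it
  is odd in \<open>x\<close>.  Using both at once gives \<open>\<bar>K\<bar> \<le> C * x * y\<^sup>2 * t powr (-2)\<close>
  (\<open>heat_kernel_remainder_bound\<close>); the power of \<open>t\<close> is dictated by the parabolic scaling
  \<open>x, y \<sim> sqrt t\<close>, so that it suffices to treat the Gaussian \<open>exp (- z\<^sup>2)\<close> (\<open>gaussian_remainder_bound\<close>).

  The factor \<open>x\<close> is absorbed by the weight \<open>1 / (x + 1)\<close>, which makes the bound uniform in \<open>x\<close>, and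
  the factor \<open>y\<^sup>2\<close> by the second moment of \<open>\<bar>u0\<bar>\<close>, which is finite.  After multiplication by
  \<open>t powr (3/2)\<close> a factor \<open>t powr (-1/2)\<close> remains, and it tends to \<open>0\<close>.
\<close>

section \<open>The remainder of the reflected Gaussian\<close>

text \<open>At \<open>a = 0\<close> the second difference vanishes because \<open>f\<close> is odd, and its derivative in \<open>a\<close> is the
  second difference of \<open>f'\<close>, which costs one more derivative for a factor \<open>b\<close>.  Hence a bound that is
  only of first order in \<open>b\<close>, but gains the factor \<open>a\<close>.\<close>

lemma odd_second_difference_bound:
  fixes f f' f'' :: "real \<Rightarrow> real"
  assumes f: "\<And>z. (f has_real_derivative f' z) (at z)"
    and f': "\<And>z. (f' has_real_derivative f'' z) (at z)"
    and bound: "\<And>z. \<bar>f'' z\<bar> \<le> B"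
    and odd: "\<And>z. f (- z) = - f z"
    and "a \<ge> 0" "b \<ge> 0"
  shows "\<bar>f (a - b) + f (a + b) - 2 * f a\<bar> \<le> 2 * B * a * b"
proof -
  define g where "g = (\<lambda>z. f (z - b) + f (z + b) - 2 * f z)"
  have lip: "\<bar>f' v - f' w\<bar> \<le> B * \<bar>v - w\<bar>" for v w
    using field_differentiable_bound[of UNIV f' f'' B v w] f' bound by simp
  have g': "(g has_real_derivative f' (z - b) + f' (z + b) - 2 * f' z) (at z)" for z
  proof -
    have "((\<lambda>z. f (z - b)) has_real_derivative f' (z - b) * 1) (at z)"
      by (rule DERIV_chain2[OF f]) (auto intro!: derivative_eq_intros)
    moreover have "((\<lambda>z. f (z + b)) has_real_derivative f' (z + b) * 1) (at z)"
      by (rule DERIV_chain2[OF f]) (auto intro!: derivative_eq_intros)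
    ultimately show ?thesis
      unfolding g_def by (auto intro!: derivative_eq_intros f)
  qed
  have "\<bar>f' (z - b) + f' (z + b) - 2 * f' z\<bar> \<le> 2 * B * b" for z
    using lip[of "z - b" z] lip[of "z + b" z] \<open>b \<ge> 0\<close> by simp
  hence "\<bar>g a - g 0\<bar> \<le> 2 * B * b * \<bar>a - 0\<bar>"
    using field_differentiable_bound[of UNIV g "\<lambda>z. f' (z - b) + f' (z + b) - 2 * f' z"
      "2 * B * b" a 0] g' by simp
  moreover have "g 0 = 0"
    using odd[of 0] odd[of b] by (simp add: g_def)
  ultimately show ?thesis
    using \<open>a \<ge> 0\<close> by (simp add: g_def algebra_simps)
qed

lemma abs_third_derivative_gaussian_le:
  fixes z :: real
  shows "\<bar>(8 * z ^ 3 - 12 * z) * exp (- (z\<^sup>2))\<bar> \<le> 20"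
proof -
  \<comment> \<open>The cubic is at most \<open>20 * (1 + z\<^sup>2 + z\<^sup>4 / 2)\<close>, and the bracket starts the series of \<open>exp (z\<^sup>2)\<close>.\<close>
  have e: "1 + z\<^sup>2 + (z\<^sup>2)\<^sup>2 / 2 \<le> exp (z\<^sup>2)"
    by (rule exp_lower_Taylor_quadratic) simp
  have lin: "\<bar>z\<bar> \<le> (1 + z\<^sup>2) / 2"
    using zero_le_power2[of "\<bar>z\<bar> - 1"] by (simp add: power2_eq_square algebra_simps)
  have cub: "\<bar>z\<bar> ^ 3 \<le> (z\<^sup>2 + (z\<^sup>2)\<^sup>2) / 2"
  proof -
    have "\<bar>z\<bar> ^ 3 = \<bar>z\<bar> * z\<^sup>2" by (simp add: power3_eq_cube power2_eq_square)
    also have "\<dots> \<le> (1 + z\<^sup>2) / 2 * z\<^sup>2"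
      using lin by (rule mult_right_mono) simp
    finally show ?thesis by (simp add: power2_eq_square algebra_simps)
  qed
  have "\<bar>8 * z ^ 3 - 12 * z\<bar> \<le> 8 * \<bar>z\<bar> ^ 3 + 12 * \<bar>z\<bar>"
    using abs_triangle_ineq4[of "8 * z ^ 3" "12 * z"] by (simp add: abs_mult power_abs)
  hence "\<bar>8 * z ^ 3 - 12 * z\<bar> \<le> 20 * exp (z\<^sup>2)"
    using lin cub e zero_le_power2[of z] zero_le_power2[of "z\<^sup>2"] by argo
  hence "\<bar>8 * z ^ 3 - 12 * z\<bar> * exp (- (z\<^sup>2)) \<le> 20 * exp (z\<^sup>2) * exp (- (z\<^sup>2))"
    by (rule mult_right_mono) simp
  thus ?thesis by (simp add: abs_mult exp_minus field_simps)
qed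

text \<open>The remainder vanishes at \<open>b = 0\<close>, and its derivative in \<open>b\<close> is a second difference of the odd
  function \<open>z \<mapsto> 2 * z * exp (- z\<^sup>2)\<close>.\<close>

lemma gaussian_remainder_bound:
  fixes a b :: real
  assumes "a \<ge> 0" "b \<ge> 0"
  shows "\<bar>exp (- ((a - b)\<^sup>2)) - exp (- ((a + b)\<^sup>2)) - 4 * a * b * exp (- (a\<^sup>2))\<bar> \<le> 40 * a * b\<^sup>2"
proof -
  define f :: "real \<Rightarrow> real" where "f = (\<lambda>z. 2 * z * exp (- (z\<^sup>2)))"
  define k where "k = (\<lambda>s. exp (- ((a - s)\<^sup>2)) - exp (- ((a + s)\<^sup>2)) - 4 * a * s * exp (- (a\<^sup>2)))"
  have f: "(f has_real_derivative (2 - 4 * z\<^sup>2) * exp (- (z\<^sup>2))) (at z)" for z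
    unfolding f_def by (auto intro!: derivative_eq_intros simp: power2_eq_square algebra_simps)
  have f': "((\<lambda>z. (2 - 4 * z\<^sup>2) * exp (- (z\<^sup>2))) has_real_derivative
      (8 * z ^ 3 - 12 * z) * exp (- (z\<^sup>2))) (at z)" for z :: real
    by (auto intro!: derivative_eq_intros simp: power2_eq_square power3_eq_cube algebra_simps)
  have diff: "\<bar>f (a - s) + f (a + s) - 2 * f a\<bar> \<le> 40 * a * b" if "s \<in> {0..b}" for s
  proof -
    have "\<bar>f (a - s) + f (a + s) - 2 * f a\<bar> \<le> 2 * 20 * a * s"
      by (rule odd_second_difference_bound[OF f f' abs_third_derivative_gaussian_le])
        (use that assms in \<open>auto simp: f_def\<close>)
    also have "\<dots> \<le> 2 * 20 * a * b"
      using that assms by (intro mult_left_mono) auto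
    finally show ?thesis by simp
  qed
  have "(k has_real_derivative f (a - s) + f (a + s) - 2 * f a) (at s within {0..b})" for s
    unfolding k_def f_def by (auto intro!: derivative_eq_intros simp: algebra_simps)
  hence "\<bar>k b - k 0\<bar> \<le> 40 * a * b * \<bar>b - 0\<bar>"
    using field_differentiable_bound[of "{0..b}" k "\<lambda>s. f (a - s) + f (a + s) - 2 * f a"
      "40 * a * b" b 0] diff assms by simp
  thus ?thesis
    using assms by (simp add: k_def power2_eq_square)
qed

section \<open>The heat kernel and its dipole\<close>

lemma heat_kernel_scaled:
  assumes "t > 0"
  shows "heat_kernel z t = (4 * pi * t) powr (-1/2) * exp (- ((z / (2 * sqrt t))\<^sup>2))"
  using assms by (simp add: heat_kernel_def power_divide power_mult_distrib)

lemma dipole_eq: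
  assumes "t > 0"
  shows "dipole x t = - (x / (2 * t)) * heat_kernel x t"
  unfolding dipole_def
  by (rule DERIV_imp_deriv, unfold heat_kernel_def)
    (use assms in \<open>auto intro!: derivative_eq_intros simp: field_simps\<close>)

lemma heat_kernel_remainder_bound:
  assumes "t > 0" "x \<ge> 0" "y \<ge> 0"
  shows "t powr (3/2) * \<bar>heat_kernel (x - y) t - heat_kernel (x + y) t + 2 * y * dipole x t\<bar>
    \<le> 5 * (4 * pi * t) powr (-1/2) * x * y\<^sup>2"
proof -
  define a b c where "a = x / (2 * sqrt t)" and "b = y / (2 * sqrt t)"
    and "c = (4 * pi * t) powr (-1/2)"
  have t32: "t powr (3/2) = t * sqrt t"
    using assms powr_add[of t 1 "1/2"] by (simp add: powr_half_sqrt)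
  have "a \<ge> 0" "b \<ge> 0" "c \<ge> 0"
    using assms by (auto simp: a_def b_def c_def)
  have ab: "4 * a * b = x * y / t"
    using assms by (simp add: a_def b_def)
  have "heat_kernel (x - y) t = c * exp (- ((a - b)\<^sup>2))"
    and "heat_kernel (x + y) t = c * exp (- ((a + b)\<^sup>2))"
    and "2 * y * dipole x t = - (x * y / t) * (c * exp (- (a\<^sup>2)))"
    using assms
    by (simp_all add: dipole_eq heat_kernel_scaled a_def b_def c_def diff_divide_distrib
        add_divide_distrib)
  hence "heat_kernel (x - y) t - heat_kernel (x + y) t + 2 * y * dipole x t
      = c * (exp (- ((a - b)\<^sup>2)) - exp (- ((a + b)\<^sup>2)) - 4 * a * b * exp (- (a\<^sup>2)))"
    unfolding ab by (simp add: algebra_simps)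
  hence "t powr (3/2) * \<bar>heat_kernel (x - y) t - heat_kernel (x + y) t + 2 * y * dipole x t\<bar>
      = t powr (3/2) * c *
        \<bar>exp (- ((a - b)\<^sup>2)) - exp (- ((a + b)\<^sup>2)) - 4 * a * b * exp (- (a\<^sup>2))\<bar>"
    using \<open>c \<ge> 0\<close> by (simp add: abs_mult)
  also have "\<dots> \<le> t powr (3/2) * c * (40 * a * b\<^sup>2)"
    using \<open>c \<ge> 0\<close> \<open>a \<ge> 0\<close> \<open>b \<ge> 0\<close>
    by (intro mult_left_mono gaussian_remainder_bound) auto
  also have "\<dots> = 5 * c * x * y\<^sup>2"
    using assms unfolding t32 by (simp add: a_def b_def power_divide power_mult_distrib)
  finally show ?thesis by (simp add: c_def)
qed

lemma abs_heat_kernel_le: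
  assumes "t > 0"
  shows "\<bar>heat_kernel z t\<bar> \<le> (4 * pi * t) powr (-1/2)"
  using assms by (simp add: heat_kernel_def mult_left_le)

lemma borel_measurable_heat_kernel [measurable]:
  "(\<lambda>z. heat_kernel z t) \<in> borel_measurable borel"
  unfolding heat_kernel_def by measurable

section \<open>Moments of the initial datum\<close>

abbreviation halfline :: "real measure" where
  "halfline \<equiv> lebesgue_on {0<..}"

lemma AE_halfline: "AE y in halfline. 0 < y"
  by (rule AE_I2) simp

lemma borel_imp_halfline_measurable:
  fixes f :: "real \<Rightarrow> real"
  assumes "f \<in> borel_measurable borel"
  shows "f \<in> borel_measurable halfline"
  using assms by (intro measurable_restrict_space1 measurable_completion) simp

lemma weighted_L1_measurable:
  assumes "u0 \<in> weighted_L1"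
  shows "u0 \<in> borel_measurable halfline"
  using borel_measurable_integrable[of "density halfline (\<lambda>x. ennreal (1 + x + x\<^sup>2))" u0] assms
  by (simp add: weighted_L1_def)

lemma integrable_weighted_L1_times:
  fixes h :: "real \<Rightarrow> real"
  assumes u0: "u0 \<in> weighted_L1"
    and h: "h \<in> borel_measurable borel"
    and bound: "\<And>y. y > 0 \<Longrightarrow> \<bar>h y\<bar> \<le> C * (1 + y + y\<^sup>2)"
  shows "integrable halfline (\<lambda>y. h y * u0 y)"
proof (rule Bochner_Integration.integrable_bound)
  have [measurable]: "u0 \<in> borel_measurable halfline"
    using u0 by (rule weighted_L1_measurable)
  have [measurable]: "h \<in> borel_measurable halfline"
    "(\<lambda>y. 1 + y + y\<^sup>2 :: real) \<in> borel_measurable halfline"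
    using h by (auto intro!: borel_imp_halfline_measurable)
  have "integrable halfline (\<lambda>y. (1 + y + y\<^sup>2) * u0 y)"
  proof (subst integrable_density[where f = u0, symmetric, simplified])
    show "AE y in halfline. 0 \<le> 1 + y + y\<^sup>2"
      using AE_halfline by eventually_elim simp
    show "integrable (density halfline (\<lambda>x. ennreal (1 + x + x\<^sup>2))) u0"
      using u0 by (simp add: weighted_L1_def)
  qed auto
  thus "integrable halfline (\<lambda>y. C * ((1 + y + y\<^sup>2) * u0 y))" by simp
  show "(\<lambda>y. h y * u0 y) \<in> borel_measurable halfline" by measurable
  show "AE y in halfline. norm (h y * u0 y) \<le> norm (C * ((1 + y + y\<^sup>2) * u0 y))"
    using AE_halfline
  proof eventually_elim
    case (elim y)
    have "\<bar>h y\<bar> \<le> \<bar>C * (1 + y + y\<^sup>2)\<bar>"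
      using bound[OF elim] by linarith
    hence "\<bar>h y\<bar> * \<bar>u0 y\<bar> \<le> \<bar>C * (1 + y + y\<^sup>2)\<bar> * \<bar>u0 y\<bar>"
      by (rule mult_right_mono) simp
    thus ?case by (simp add: abs_mult mult.assoc)
  qed
qed

lemma set_integral_halfline:
  fixes f :: "real \<Rightarrow> real"
  shows "(LINT y:{0<..}|lebesgue. f y) = integral\<^sup>L halfline f"
  by (simp add: set_lebesgue_integral_def integral_restrict_space)

text \<open>Writing both terms as integrals against \<open>u0\<close> reduces the claim to
  \<open>heat_kernel_remainder_bound\<close>; the explicit right-hand side also shows the rate \<open>t powr (-1/2)\<close>.\<close>

lemma halfline_heat_dipole_bound:
  assumes u0: "u0 \<in> weighted_L1" and "t > 0" "x \<ge> 0"
  shows "t powr (3/2) / (x + 1) * \<bar>halfline_heat u0 x t + 2 * first_moment u0 * dipole x t\<bar>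
    \<le> 5 * (4 * pi * t) powr (-1/2) * (LINT y|halfline. y\<^sup>2 * \<bar>u0 y\<bar>)"
proof -
  define c where "c = (4 * pi * t) powr (-1/2)"
  define G where "G = (\<lambda>y. heat_kernel (x - y) t - heat_kernel (x + y) t)"
  define I where "I = (LINT y|halfline. y\<^sup>2 * \<bar>u0 y\<bar>)"
  have int_G: "integrable halfline (\<lambda>y. G y * u0 y)"
  proof (rule integrable_weighted_L1_times[OF u0])
    show "G \<in> borel_measurable borel" unfolding G_def by measurable
    fix y :: real assume "y > 0"
    have "\<bar>G y\<bar> \<le> 2 * c * 1"
      using abs_heat_kernel_le[OF \<open>t > 0\<close>, of "x - y"] abs_heat_kernel_le[OF \<open>t > 0\<close>, of "x + y"]
      by (simp add: G_def c_def)
    also have "\<dots> \<le> 2 * c * (1 + y + y\<^sup>2)"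
      using \<open>y > 0\<close> by (intro mult_left_mono) (auto simp: c_def)
    finally show "\<bar>G y\<bar> \<le> 2 * c * (1 + y + y\<^sup>2)" .
  qed
  have int_1: "integrable halfline (\<lambda>y. y * u0 y)"
    by (rule integrable_weighted_L1_times[OF u0, where C = 1]) auto
  have "integrable halfline (\<lambda>y. y\<^sup>2 * u0 y)"
    by (rule integrable_weighted_L1_times[OF u0, where C = 1]) auto
  hence int_2: "integrable halfline (\<lambda>y. y\<^sup>2 * \<bar>u0 y\<bar>)"
    using integrable_abs by (fastforce simp: abs_mult)
  have "I \<ge> 0" unfolding I_def by (rule integral_nonneg_AE) simp
  have "halfline_heat u0 x t + 2 * first_moment u0 * dipole x t
      = (LINT y|halfline. G y * u0 y) + (LINT y|halfline. 2 * dipole x t * (y * u0 y))"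
    unfolding halfline_heat_def first_moment_def set_integral_halfline G_def
    by (simp add: mult.commute)
  also have "\<dots> = (LINT y|halfline. G y * u0 y + 2 * dipole x t * (y * u0 y))"
    using int_G int_1 by simp
  finally have "t powr (3/2) * \<bar>halfline_heat u0 x t + 2 * first_moment u0 * dipole x t\<bar>
      = \<bar>LINT y|halfline. t powr (3/2) * (G y * u0 y + 2 * dipole x t * (y * u0 y))\<bar>"
    by (simp add: abs_mult)
  also have "\<dots> \<le> (LINT y|halfline. \<bar>t powr (3/2) * (G y * u0 y + 2 * dipole x t * (y * u0 y))\<bar>)"
    by (rule integral_abs_bound)
  also have "\<dots> \<le> (LINT y|halfline. 5 * c * x * (y\<^sup>2 * \<bar>u0 y\<bar>))"
  proof (rule integral_mono_AE)
    show "AE y in halfline. \<bar>t powr (3/2) * (G y * u0 y + 2 * dipole x t * (y * u0 y))\<bar>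
        \<le> 5 * c * x * (y\<^sup>2 * \<bar>u0 y\<bar>)"
      using AE_halfline
    proof eventually_elim
      case (elim y)
      have "\<bar>t powr (3/2) * (G y * u0 y + 2 * dipole x t * (y * u0 y))\<bar>
          = t powr (3/2) * \<bar>G y + 2 * y * dipole x t\<bar> * \<bar>u0 y\<bar>"
      proof -
        have "t powr (3/2) * (G y * u0 y + 2 * dipole x t * (y * u0 y))
            = t powr (3/2) * (G y + 2 * y * dipole x t) * u0 y"
          by (simp add: algebra_simps)
        thus ?thesis by (simp only: abs_mult) simp
      qed
      also have "\<dots> \<le> 5 * c * x * y\<^sup>2 * \<bar>u0 y\<bar>"
        using heat_kernel_remainder_bound[of t x y] assms elim
        by (intro mult_right_mono) (auto simp: G_def c_def)
      finally show ?case by (simp add: mult.assoc)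
    qed
  qed (use int_G int_1 int_2 in auto)
  also have "\<dots> = 5 * c * I * x" by (simp add: I_def)
  also have "\<dots> \<le> 5 * c * I * (x + 1)"
    using \<open>I \<ge> 0\<close> by (intro mult_left_mono) (auto simp: c_def)
  finally show ?thesis
    using \<open>x \<ge> 0\<close> by (simp add: divide_le_eq c_def I_def)
qed

section \<open>Dipole asymptotics on the half-line\<close>

theorem theorem1p1:
  fixes u0 :: "real \<Rightarrow> real"
  assumes "u0 \<in> weighted_L1"
  shows "((\<lambda>t::real. SUP x\<in>{0::real..}.
            ennreal (t powr (3/2) / (x + 1) *
              \<bar>halfline_heat u0 x t + 2 * first_moment u0 * dipole x t\<bar>))
          \<longlongrightarrow> 0) at_top"
proof (rule tendsto_sandwich[where f = "\<lambda>_. 0"])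
  define I where "I = (LINT y|halfline. y\<^sup>2 * \<bar>u0 y\<bar>)"
  have "LIM t at_top. 4 * pi * t :> at_top"
    by (intro filterlim_tendsto_pos_mult_at_top[OF tendsto_const]) (auto simp: filterlim_ident)
  hence "((\<lambda>t::real. (4 * pi * t) powr (-1/2)) \<longlongrightarrow> 0) at_top"
    by (intro tendsto_neg_powr) auto
  hence "((\<lambda>t::real. 5 * (4 * pi * t) powr (-1/2) * I) \<longlongrightarrow> 5 * 0 * I) at_top"
    by (intro tendsto_intros)
  hence "((\<lambda>t::real. ennreal (5 * (4 * pi * t) powr (-1/2) * I)) \<longlongrightarrow> ennreal (5 * 0 * I)) at_top"
    by (rule tendsto_ennrealI)
  thus "((\<lambda>t::real. ennreal (5 * (4 * pi * t) powr (-1/2) * I)) \<longlongrightarrow> 0) at_top" by simp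
  show "eventually (\<lambda>t. (SUP x\<in>{0::real..}. ennreal (t powr (3/2) / (x + 1) *
        \<bar>halfline_heat u0 x t + 2 * first_moment u0 * dipole x t\<bar>))
      \<le> ennreal (5 * (4 * pi * t) powr (-1/2) * I)) at_top"
    using eventually_gt_at_top[of 0]
  proof eventually_elim
    case (elim t)
    show ?case
      using halfline_heat_dipole_bound[OF assms elim] unfolding I_def
      by (intro SUP_least ennreal_leI) auto
  qed
qed simp_all

end
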